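(* Let $a\ge 1$, let $p=(p_1,\dots,p_a)$ be a probability vector with all $p_s>0$, let $n\ge 2$, and let $\mathcal{B}_n^p$ denote the number of branches in a $p$-biased recursive tree of order $n$. Then $$\mathbb{E}[\mathcal{B}_{n}^{p}] = \sum_{s=1}^{a-1} \frac{p_s}{\sum_{\ell=1}^{s} p_{\ell}} \left( 1- \Big(\sum_{\ell=s+1}^{a} p_{\ell} \Big)^{n-1} \right) + p_a .$$ Moreover, $$\mathbb{E}[\mathcal{B}_{n}^{p}] \xrightarrow[n \to \infty]{} \sum_{s=1}^{a} \frac{p_s}{\sum_{\ell=1}^{s} p_{\ell}} .$$ When $a\ge 2$ and $p$ is the uniform distribution over $[a]$, writing $\mathcal{B}_n^{a}$ for the number of branches in an $a$-recursive tree of order $n$, $$\mathbb{E}[\mathcal{B}_{n}^{a}]= \sum_{s=1}^{a-1} \frac{1}{s} \left( 1- \Big( 1- \frac{s}{a}\Big)^{n-1} \right)+ \frac{1}{a}.$$ For fixed $a$, $\mathbb{E}[\mathcal{B}_{n}^{a}] \to H_a$ as $n\to\infty$; and for fixed $n$, $\mathbb{E}[\mathcal{B}_{n}^{a}] \to H_{n-1}$ as $a\to\infty$, which is the expected number of branches of a uniform recursive tree of order $n$. Here $H_m=\sum_{i=1}^m \frac1i$.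
   Context: $[a]=\{1,\dots,a\}$. A probability vector $p=(p_1,\dots,p_a)$ has all $p_s>0$ and $\sum_s p_s=1$. $p$-biased riffle shuffle of $\{2,\dots,n\}$: start with the deck $2,3,\dots,n$ in increasing order; cut it into $a$ consecutive piles whose sizes $(b_1,\dots,b_a)$ (pile 1 consisting of the $b_1$ smallest cards, etc.) have the multinomial$(n-1;p)$ distribution; then choose uniformly one of the $\binom{n-1}{b_1,\dots,b_a}$ ways of interleaving the piles keeping the cards of each pile in their original order. The resulting arrangement $\gamma=(\gamma(2),\dots,\gamma(n))$ is the $p$-biased riffle shuffle permutation of $\{2,\dots,n\}$, where $\gamma(j)$ is the card in position $j$. $p$-biased recursive tree ($p$-BRT) of order $n$: the random rooted tree on vertices $1,\dots,n$ with root $1$, obtained by attaching each node $i\ge 2$ to the rightmost element $j$ of $\gamma$ which precedes $i$ and satisfies $j<i$; if there is no such $j$, the parent of $i$ is $1$. When $p$ is uniform over $[a]$, $a\ge2$, it is called an $a$-recursive tree ($a$-RT). The number of branches of a tree is the degree of its root. A uniform recursive tree (URT) of order $n$ is a uniformly random tree among the $(n-1)!$ increasing rooted trees on $\{1,\dots,n\}$ (labels increase along every path away from the root $1$). *)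

theory Defs
  imports "HOL-Probability.Probability"
begin

section \<open>Biased riffle shuffles\<close>

definition prob_vector :: "nat \<Rightarrow> (nat \<Rightarrow> real) \<Rightarrow> bool" where
  "prob_vector a p \<longleftrightarrow> (\<forall>s\<in>{1..a}. p s > 0) \<and> (\<Sum>s=1..a. p s) = 1"

text \<open>
  Count vectors are functions on the natural numbers that vanish outside \<open>{1..a}\<close>, so that
  each vector \<open>(b\<^sub>1, \<dots>, b\<^sub>a)\<close> is represented exactly once.
\<close>

definition multinomial_pmf :: "nat \<Rightarrow> (nat \<Rightarrow> real) \<Rightarrow> nat \<Rightarrow> (nat \<Rightarrow> nat) pmf" where
  "multinomial_pmf a p m = embed_pmf (\<lambda>b.
     if (\<forall>s. s \<notin> {1..a} \<longrightarrow> b s = 0) \<and> (\<Sum>s=1..a. b s) = m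
     then fact m / (\<Prod>s=1..a. fact (b s)) * (\<Prod>s=1..a. p s ^ b s)
     else 0)"

definition pile :: "(nat \<Rightarrow> nat) \<Rightarrow> nat \<Rightarrow> nat list" where
  "pile b s = [2 + (\<Sum>l=1..<s. b l) ..< 2 + (\<Sum>l=1..s. b l)]"

text \<open>
  Arrangements are lists of cards: the card in position \<open>j \<in> {2..n}\<close> is the list entry with
  index \<open>j - 2\<close>. The cards are distinct, so for given pile sizes distinct interleavings are
  distinct arrangements.
\<close>

definition interleavings :: "nat \<Rightarrow> nat \<Rightarrow> (nat \<Rightarrow> nat) \<Rightarrow> nat list set" where
  "interleavings a n b =
     {\<gamma> \<in> permutations_of_set {2..n}. \<forall>s\<in>{1..a}. filter (\<lambda>c. c \<in> set (pile b s)) \<gamma> = pile b s}"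

definition riffle_pmf :: "nat \<Rightarrow> (nat \<Rightarrow> real) \<Rightarrow> nat \<Rightarrow> nat list pmf" where
  "riffle_pmf a p n =
     bind_pmf (multinomial_pmf a p (n - 1)) (\<lambda>b. pmf_of_set (interleavings a n b))"


section \<open>Trees\<close>

text \<open>
  A tree on the vertex set \<open>{1..n}\<close>, always rooted at 1, is given by its set of undirected edges.
\<close>

definition is_path :: "'a set set \<Rightarrow> 'a list \<Rightarrow> bool" where
  "is_path E xs \<longleftrightarrow> xs \<noteq> [] \<and> distinct xs \<and> successively (\<lambda>u v. {u, v} \<in> E) xs"

definition is_tree :: "'a set \<Rightarrow> 'a set set \<Rightarrow> bool" where
  "is_tree V E \<longleftrightarrow>
     V \<noteq> {} \<and> E \<subseteq> {{u, v} | u v. u \<in> V \<and> v \<in> V \<and> u \<noteq> v} \<and>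
     (\<forall>u\<in>V. \<forall>v\<in>V. \<exists>!xs. is_path E xs \<and> hd xs = u \<and> last xs = v)"

definition increasing_trees :: "nat \<Rightarrow> nat set set set" where
  "increasing_trees n =
     {E. is_tree {1..n} E \<and> (\<forall>xs. is_path E xs \<and> hd xs = 1 \<longrightarrow> sorted_wrt (<) xs)}"

definition urt :: "nat \<Rightarrow> nat set set pmf" where
  "urt n = pmf_of_set (increasing_trees n)"

definition branches :: "nat set set \<Rightarrow> nat" where
  "branches E = card {e \<in> E. 1 \<in> e}"

definition brt_parent :: "nat list \<Rightarrow> nat \<Rightarrow> nat" where
  "brt_parent \<gamma> i =
     (let js = filter (\<lambda>j. j < i) (takeWhile (\<lambda>j. j \<noteq> i) \<gamma>) in if js = [] then 1 else last js)"

definition brt :: "nat \<Rightarrow> (nat \<Rightarrow> real) \<Rightarrow> nat \<Rightarrow> nat set set pmf" where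
  "brt a p n = map_pmf (\<lambda>\<gamma>. {{brt_parent \<gamma> i, i} | i. i \<in> {2..n}}) (riffle_pmf a p n)"

definition rt :: "nat \<Rightarrow> nat \<Rightarrow> nat set set pmf" where
  "rt a n = brt a (\<lambda>s. 1 / real a) n"

definition expected_branches :: "nat set set pmf \<Rightarrow> real" where
  "expected_branches T = measure_pmf.expectation T (\<lambda>E. real (branches E))"

end

theory Submission imports Defs begin

text \<open>
  The branches of a recursive tree built from an arrangement \<open>\<gamma>\<close> correspond to the cards that
  no smaller card precedes, that is, to the left-to-right minima of \<open>\<gamma>\<close> (\<open>branches_brt\<close>).
  Write below each card the number of its pile. An interleaving with pile sizes \<open>b\<close> is determined
  by the resulting word, which can be any word with letter counts \<open>b\<close>
  (\<open>bij_betw_interleavings_words\<close>), and the left-to-right minima of \<open>\<gamma>\<close> are in the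
  same positions as the strict left-to-right minima of the word
  (\<open>num_lr_minima_interleaving\<close>). Under the multinomial distribution of \<open>b\<close> the
  \<open>n - 1\<close> letters of the word are independent with distribution \<open>p\<close>
  (\<open>expected_branches_brt_words\<close>).

  The letter following \<open>j\<close> others equals \<open>s\<close> and is a strict left-to-right minimum with
  probability \<open>p s * q s ^ j\<close>, where \<open>q s\<close> is the sum of \<open>p l\<close> over \<open>l > s\<close>.
  Summing the geometric series over \<open>j < n - 1\<close> gives the formula for the expectation, and
  \<open>q s < 1\<close> gives its limit for \<open>n\<close> tending to infinity. In the uniform case the limit in
  \<open>a\<close> is that of a Riemann sum, which comes down to the asymptotics of sums of powers
  (\<open>harmonic_riemann_sum\<close>).

  Increasing trees correspond to the maps that give every vertex \<open>i \<ge> 2\<close> a smaller parent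
  (\<open>increasing_trees_eq\<close>, \<open>inj_on_parent_edges\<close>). The parent of \<open>i\<close> is the root for a
  proportion \<open>1 / (i - 1)\<close> of these maps, so the expected number of branches of a uniform
  recursive tree is a harmonic number (\<open>expected_branches_urt\<close>).
\<close>

section \<open>Left-to-right minima of random words\<close>

text \<open>
  The words of length \<open>m\<close> over the alphabet \<open>A\<close>.
\<close>

definition words :: "'a set \<Rightarrow> nat \<Rightarrow> 'a list set" where
  "words A m = {w. set w \<subseteq> A \<and> length w = m}"

text \<open>
  The number of strict left-to-right minima of a list, that is, of entries smaller than every
  entry before them. Positions are counted from \<open>0\<close>; the first entry always qualifies.
\<close>

definition num_lr_minima :: "'a::linorder list \<Rightarrow> nat" where
  "num_lr_minima w = card {j. j < length w \<and> (\<forall>i<j. w ! j < w ! i)}"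

lemma finite_words: "finite A \<Longrightarrow> finite (words A m)"
  unfolding words_def by (rule finite_lists_length_eq)

lemma words_0 [simp]: "words A 0 = {[]}"
  by (auto simp: words_def)

lemma sum_words_Suc:
  "(\<Sum>w\<in>words A (Suc m). h w) = (\<Sum>w\<in>words A m. \<Sum>x\<in>A. h (w @ [x]))"
proof -
  have "(\<Sum>w\<in>words A (Suc m). h w) = (\<Sum>(w, x)\<in>words A m \<times> A. h (w @ [x]))"
  proof (rule sum.reindex_bij_witness[of _ "\<lambda>(w, x). w @ [x]" "\<lambda>w. (butlast w, last w)"])
    fix w assume w: "w \<in> words A (Suc m)"
    then have "w \<noteq> []" by (auto simp: words_def)
    then show "(butlast w, last w) \<in> words A m \<times> A"
      using w by (auto simp: words_def dest: in_set_butlastD)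
    show "(case (butlast w, last w) of (w, x) \<Rightarrow> w @ [x]) = w"
      using \<open>w \<noteq> []\<close> by simp
    then show "(case (butlast w, last w) of (w, x) \<Rightarrow> h (w @ [x])) = h w"
      by simp
  qed (auto simp: words_def)
  then show ?thesis by (simp add: sum.cartesian_product)
qed

lemma sum_words_weight:
  fixes p :: "'a \<Rightarrow> real"
  shows "(\<Sum>w\<in>words A m. prod_list (map p w)) = (\<Sum>x\<in>A. p x) ^ m"
  by (induction m) (simp_all add: sum_words_Suc flip: sum_distrib_left sum_distrib_right)

lemma num_lr_minima_snoc:
  "num_lr_minima (w @ [x]) = num_lr_minima w + (if \<forall>y\<in>set w. x < y then 1 else 0)"
proof -
  let ?M = "\<lambda>w. {j. j < length w \<and> (\<forall>i<j. w ! j < w ! i)}"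
  have "?M (w @ [x]) = ?M w \<union> (if \<forall>y\<in>set w. x < y then {length w} else {})"
    by (auto simp: nth_append less_Suc_eq all_set_conv_all_nth)
  then show ?thesis
    unfolding num_lr_minima_def by (auto simp: card_insert_if)
qed

text \<open>
  If the letters of a word of length \<open>m\<close> are drawn independently from \<open>{1..a}\<close> with
  probabilities \<open>p\<close>, the left-hand side is the expected number of strict left-to-right minima. The letter after \<open>j\<close> others equals
  \<open>s\<close> and is a new minimum exactly if all \<open>j\<close> earlier letters lie in \<open>{s+1..a}\<close>.
\<close>

lemma sum_words_num_lr_minima:
  fixes p :: "nat \<Rightarrow> real"
  assumes "(\<Sum>s=1..a. p s) = 1"
  shows "(\<Sum>w\<in>words {1..a} m. prod_list (map p w) * real (num_lr_minima w)) =
         (\<Sum>s=1..a. p s * (\<Sum>j<m. (\<Sum>l=s+1..a. p l) ^ j))"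
proof (induction m)
  case 0
  then show ?case by (simp add: num_lr_minima_def)
next
  case (Suc m)
  let ?W = "words {1..a} m"
  have tail: "(\<Sum>w\<in>?W. prod_list (map p w) * (if \<forall>y\<in>set w. s < y then 1 else 0)) =
      (\<Sum>l=s+1..a. p l) ^ m" if "s \<in> {1..a}" for s
  proof -
    have "words {s+1..a} m = {w\<in>?W. \<forall>y\<in>set w. s < y}"
      using that by (force simp: words_def)
    then have "(\<Sum>w\<in>words {s+1..a} m. prod_list (map p w)) =
        (\<Sum>w\<in>?W. if \<forall>y\<in>set w. s < y then prod_list (map p w) else 0)"
      by (simp add: sum.inter_filter finite_words)
    also have "\<dots> = (\<Sum>w\<in>?W. prod_list (map p w) * (if \<forall>y\<in>set w. s < y then 1 else 0))"
      by (intro sum.cong) auto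
    finally show ?thesis
      by (simp only: sum_words_weight)
  qed
  have "(\<Sum>w\<in>words {1..a} (Suc m). prod_list (map p w) * real (num_lr_minima w)) =
     (\<Sum>w\<in>?W. \<Sum>s=1..a. p s * (prod_list (map p w) * real (num_lr_minima w)) +
        p s * (prod_list (map p w) * (if \<forall>y\<in>set w. s < y then 1 else 0)))"
    unfolding sum_words_Suc by (intro sum.cong) (auto simp: num_lr_minima_snoc algebra_simps)
  also have "\<dots> = (\<Sum>w\<in>?W. (\<Sum>s=1..a. p s) * (prod_list (map p w) * real (num_lr_minima w))) +
     (\<Sum>s=1..a. \<Sum>w\<in>?W. p s * (prod_list (map p w) * (if \<forall>y\<in>set w. s < y then 1 else 0)))"
    unfolding sum.distrib sum_distrib_right by (subst (2) sum.swap) simp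
  also have "\<dots> = (\<Sum>s=1..a. p s * (\<Sum>j<m. (\<Sum>l=s+1..a. p l) ^ j)) +
     (\<Sum>s=1..a. p s * (\<Sum>l=s+1..a. p l) ^ m)"
    unfolding assms by (simp only: mult_1 Suc.IH tail flip: sum_distrib_left cong: sum.cong)
  finally show ?case
    by (simp add: sum.distrib algebra_simps)
qed

section \<open>Multinomial counts\<close>

text \<open>
  The letter counts of words of length \<open>m\<close> over \<open>{1..a}\<close>. For positive \<open>p\<close> this is the
  support of the multinomial distribution.
\<close>

definition count_vectors :: "nat \<Rightarrow> nat \<Rightarrow> (nat \<Rightarrow> nat) set" where
  "count_vectors a m = {b. (\<forall>s. s \<notin> {1..a} \<longrightarrow> b s = 0) \<and> (\<Sum>s=1..a. b s) = m}"

lemma size_eq_sum_count: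
  assumes "finite A" "set_mset M \<subseteq> A"
  shows "size M = (\<Sum>s\<in>A. count M s)"
  unfolding size_multiset_overloaded_eq
  using assms by (intro sum.mono_neutral_left) (auto simp: not_in_iff)

lemma count_mset_in_count_vectors: "w \<in> words {1..a} m \<Longrightarrow> count (mset w) \<in> count_vectors a m"
  using size_eq_sum_count[of "{1..a}" "mset w"]
  by (auto simp: words_def count_vectors_def count_eq_zero_iff)

lemma in_words_of_count_vector:
  assumes "b \<in> count_vectors a m" "count (mset w) = b"
  shows "w \<in> words {1..a} m"
proof -
  have sub: "set w \<subseteq> {1..a}"
  proof
    fix s assume "s \<in> set w"
    then have "b s \<noteq> 0" by (simp add: count_eq_zero_iff flip: assms(2))
    with assms(1) show "s \<in> {1..a}" by (auto simp: count_vectors_def)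
  qed
  with assms size_eq_sum_count[of "{1..a}" "mset w"] show ?thesis
    by (auto simp: words_def count_vectors_def)
qed

lemma ex_word_of_count_vector:
  assumes "b \<in> count_vectors a m"
  obtains w where "count (mset w) = b"
proof -
  obtain w where w: "mset w = (\<Sum>s\<in>{1..a}. replicate_mset (b s) s)"
    using ex_mset by blast
  have "count (mset w) s = b s" for s
    using assms unfolding w by (auto simp: count_sum count_vectors_def if_distrib sum.delta cong: if_cong)
  then show ?thesis using that by blast
qed

lemma finite_count_vectors: "finite (count_vectors a m)"
proof -
  have "count_vectors a m \<subseteq> (\<lambda>w. count (mset w)) ` words {1..a} m"
  proof
    fix b assume b: "b \<in> count_vectors a m"
    obtain w where w: "count (mset w) = b"
      by (rule ex_word_of_count_vector[OF b])
    with in_words_of_count_vector[OF b w] show "b \<in> (\<lambda>w. count (mset w)) ` words {1..a} m"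
      by blast
  qed
  then show ?thesis
    by (rule finite_subset) (simp add: finite_words)
qed

lemma sum_words_by_count:
  "(\<Sum>w\<in>words {1..a} m. h w) = (\<Sum>b\<in>count_vectors a m. \<Sum>w | count (mset w) = b. h w)"
proof -
  have "(\<Sum>w\<in>words {1..a} m. h w) =
     (\<Sum>b\<in>count_vectors a m. \<Sum>w | w \<in> words {1..a} m \<and> count (mset w) = b. h w)"
    by (rule sum.group[symmetric]) (auto simp: finite_words finite_count_vectors count_mset_in_count_vectors)
  also have "\<dots> = (\<Sum>b\<in>count_vectors a m. \<Sum>w | count (mset w) = b. h w)"
    by (intro sum.cong Collect_cong refl) (auto dest: in_words_of_count_vector)
  finally show ?thesis .
qed

lemma words_of_count_eq:
  assumes "count (mset w) = b"
  shows "{w. count (mset w) = b} = permutations_of_multiset (mset w)"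
  by (simp add: permutations_of_multiset_def count_inject flip: assms)

lemma card_words_of_count:
  assumes b: "b \<in> count_vectors a m"
  shows "real (card {w. count (mset w) = b}) = fact m / (\<Prod>s=1..a. fact (b s))"
proof -
  obtain w where w: "count (mset w) = b"
    using ex_word_of_count_vector[OF b] .
  have ww: "w \<in> words {1..a} m" by (rule in_words_of_count_vector[OF b w])
  have zero: "b s = 0" if "s \<notin> set w" for s
    using that by (simp add: count_eq_zero_iff flip: w)
  have pr: "(\<Prod>x\<in>set w. fact (count (mset w) x)) = (\<Prod>s=1..a. fact (b s) :: nat)"
    unfolding w using ww by (intro prod.mono_neutral_left) (auto simp: words_def zero)
  have "card {w. count (mset w) = b} = fact m div (\<Prod>s=1..a. fact (b s))"
    "(\<Prod>s=1..a. fact (b s) :: nat) dvd fact m"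
    using card_permutations_of_multiset[of "mset w"] ww
    unfolding words_of_count_eq[OF w] by (simp_all add: pr words_def)
  then show ?thesis by (simp add: real_of_nat_div)
qed

lemma word_weight_count:
  fixes p :: "nat \<Rightarrow> real"
  assumes b: "b \<in> count_vectors a m" and w: "count (mset w) = b"
  shows "prod_list (map p w) = (\<Prod>s=1..a. p s ^ b s)"
proof -
  have ww: "set w \<subseteq> {1..a}"
    using in_words_of_count_vector[OF b w] by (simp add: words_def)
  have zero: "b s = 0" if "s \<notin> set w" for s
    using that by (simp add: count_eq_zero_iff flip: w)
  have "prod_list (map p w) = prod_mset (image_mset p (mset w))"
    by (metis mset_map prod_mset_prod_list)
  also have "\<dots> = (\<Prod>s\<in>set w. p s ^ count (mset w) s)"
    by (simp add: image_prod_mset_multiplicity)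
  also have "\<dots> = (\<Prod>s=1..a. p s ^ b s)"
    unfolding w using ww by (intro prod.mono_neutral_left) (auto simp: zero)
  finally show ?thesis .
qed

lemma sum_words_weight_by_count:
  fixes p :: "nat \<Rightarrow> real"
  shows "(\<Sum>w\<in>words {1..a} m. prod_list (map p w) * h w) =
     (\<Sum>b\<in>count_vectors a m. (\<Prod>s=1..a. p s ^ b s) * (\<Sum>w | count (mset w) = b. h w))"
  unfolding sum_words_by_count sum_distrib_left
  by (intro sum.cong refl) (simp add: word_weight_count)

text \<open>
  The multinomial weights sum to \<open>1\<close>, because the weight of \<open>b\<close> is the total weight
  of the words with letter counts \<open>b\<close>.
\<close>

lemma pmf_multinomial:
  assumes p: "prob_vector a p"
  shows "pmf (multinomial_pmf a p m) b =
     (if b \<in> count_vectors a m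
      then fact m / (\<Prod>s=1..a. fact (b s)) * (\<Prod>s=1..a. p s ^ b s) else 0)"
proof -
  define f where "f = (\<lambda>b. if b \<in> count_vectors a m
      then fact m / (\<Prod>s=1..a. fact (b s)) * (\<Prod>s=1..a. p s ^ b s) else 0)"
  have nonneg: "0 \<le> f b" for b
  proof -
    have "0 \<le> (\<Prod>s=1..a. p s ^ b s)"
      using p by (intro prod_nonneg) (auto simp: prob_vector_def less_imp_le)
    moreover have "0 \<le> (\<Prod>s=1..a. fact (b s) :: real)"
      by (intro prod_nonneg) auto
    ultimately show ?thesis by (simp add: f_def)
  qed
  have "(\<Sum>b\<in>count_vectors a m. f b) =
      (\<Sum>b\<in>count_vectors a m. (\<Prod>s=1..a. p s ^ b s) * (\<Sum>w | count (mset w) = b. 1))"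
    by (intro sum.cong refl) (simp add: f_def card_words_of_count)
  also have "\<dots> = (\<Sum>w\<in>words {1..a} m. prod_list (map p w))"
    unfolding sum_words_weight_by_count[symmetric] by simp
  also have "\<dots> = 1"
    using p by (simp add: sum_words_weight prob_vector_def)
  finally have total: "(\<Sum>b\<in>count_vectors a m. f b) = 1" .
  have "(\<integral>\<^sup>+b. ennreal (f b) \<partial>count_space UNIV) = (\<Sum>b\<in>count_vectors a m. ennreal (f b))"
    by (intro nn_integral_count_space') (auto simp: finite_count_vectors f_def)
  also have "\<dots> = 1"
    using total by (simp add: sum_ennreal nonneg)
  finally have "pmf (embed_pmf f) b = f b"
    by (intro pmf_embed_pmf nonneg)
  moreover have "multinomial_pmf a p m = embed_pmf f"
    unfolding multinomial_pmf_def f_def count_vectors_def by simp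
  ultimately show ?thesis by (simp add: f_def)
qed

section \<open>Interleavings as words of pile numbers\<close>

text \<open>
  The number of the pile that contains card \<open>c\<close> when the pile sizes are \<open>b\<close>: the first pile
  such that it and the piles before it reach beyond \<open>c\<close>. It is meaningful for the cards
  \<open>2, ..., n\<close> only.
\<close>

definition pile_index :: "(nat \<Rightarrow> nat) \<Rightarrow> nat \<Rightarrow> nat" where
  "pile_index b c = (LEAST s. c < 2 + (\<Sum>l=1..s. b l))"

lemma in_pile_iff:
  "c \<in> set (pile b s) \<longleftrightarrow> 2 + (\<Sum>l=1..<s. b l) \<le> c \<and> c < 2 + (\<Sum>l=1..s. b l)"
  unfolding pile_def set_upt atLeastLessThan_iff ..

lemma pile_index_eq:
  assumes "c \<in> set (pile b s)"
  shows "pile_index b c = s"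
  unfolding pile_index_def
proof (rule Least_equality)
  show "c < 2 + (\<Sum>l=1..s. b l)"
    using assms by (simp add: in_pile_iff)
next
  fix t assume t: "c < 2 + (\<Sum>l=1..t. b l)"
  show "s \<le> t"
  proof (rule ccontr)
    assume "\<not> s \<le> t"
    then have "(\<Sum>l=1..t. b l) \<le> (\<Sum>l=1..<s. b l)"
      by (intro sum_mono2) auto
    with t assms show False by (simp add: in_pile_iff)
  qed
qed

lemma pile_index_mono:
  assumes "c \<le> d" "d < 2 + (\<Sum>l=1..a. b l)"
  shows "pile_index b c \<le> pile_index b d"
proof -
  have "d < 2 + (\<Sum>l=1..pile_index b d. b l)"
    unfolding pile_index_def by (rule LeastI[of _ a]) (fact assms)
  with assms(1) show ?thesis
    unfolding pile_index_def[of b c] by (intro Least_le) simp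
qed

lemma in_pile_pile_index:
  assumes "2 \<le> c" "c < 2 + (\<Sum>l=1..a. b l)"
  shows "c \<in> set (pile b (pile_index b c))"
proof -
  let ?s = "pile_index b c"
  have up: "c < 2 + (\<Sum>l=1..?s. b l)"
    unfolding pile_index_def by (rule LeastI[of _ a]) (fact assms)
  then obtain t where t: "?s = Suc t"
    using assms by (cases ?s) auto
  have "\<not> c < 2 + (\<Sum>l=1..t. b l)"
    using not_less_Least[of t "\<lambda>s. c < 2 + (\<Sum>l=1..s. b l)"] t
    unfolding pile_index_def by simp
  with up t show ?thesis
    by (simp add: in_pile_iff atLeastLessThanSuc_atLeastAtMost)
qed

lemma list_eq_by_labels:
  assumes "map lab xs = map lab ys"
    and "\<And>s. filter (\<lambda>c. lab c = s) xs = filter (\<lambda>c. lab c = s) ys"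
  shows "xs = ys"
  using assms
proof (induction xs arbitrary: ys)
  case Nil
  then show ?case by simp
next
  case (Cons x xs)
  then obtain y zs where ys: "ys = y # zs" "lab y = lab x" "map lab xs = map lab zs"
    by (cases ys) auto
  have "x = y" using Cons.prems(2)[of "lab x"] ys by simp
  moreover have "filter (\<lambda>c. lab c = s) xs = filter (\<lambda>c. lab c = s) zs" for s
    using Cons.prems(2)[of s] by (cases "lab y = s") (simp_all add: ys(1) \<open>x = y\<close>)
  ultimately show ?case using Cons.IH[of zs] ys by simp
qed

text \<open>
  Dealing from the piles in the order dictated by a word: its next letter names the pile whose
  top card comes next.
\<close>

lemma merge_piles_along_word:
  assumes "\<And>s. count (mset w) s = length (P s)"
    and "\<And>s c. c \<in> set (P s) \<Longrightarrow> lab c = s"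
  shows "\<exists>xs. map lab xs = w \<and> (\<forall>s. filter (\<lambda>c. lab c = s) xs = P s)"
  using assms
proof (induction w arbitrary: P)
  case Nil
  then show ?case by simp
next
  case (Cons x w)
  obtain c cs where P: "P x = c # cs"
    using Cons.prems(1)[of x] by (cases "P x") auto
  have c: "lab c = x" using Cons.prems(2)[of c x] P by simp
  have "\<exists>xs. map lab xs = w \<and> (\<forall>s. filter (\<lambda>c. lab c = s) xs = (P(x := cs)) s)"
  proof (rule Cons.IH)
    show "count (mset w) s = length ((P(x := cs)) s)" for s
      using Cons.prems(1)[of s] P by (auto split: if_splits)
    show "lab d = s" if "d \<in> set ((P(x := cs)) s)" for s d
      using Cons.prems(2)[of d s] that P by (auto split: if_splits)
  qed
  then obtain xs where xs: "map lab xs = w" "\<And>s. filter (\<lambda>c. lab c = s) xs = (P(x := cs)) s"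
    by blast
  have "map lab (c # xs) = x # w \<and> (\<forall>s. filter (\<lambda>c. lab c = s) (c # xs) = P s)"
    using xs c P by auto
  then show ?case by (rule exI)
qed

lemma pile_bounds:
  assumes b: "b \<in> count_vectors a (n - 1)" and n: "n \<ge> 1"
  shows "c \<in> set (pile b s) \<Longrightarrow> 2 \<le> c \<and> c \<le> n \<and> 1 \<le> s \<and> s \<le> a"
proof -
  assume c: "c \<in> set (pile b s)"
  have s1: "s \<ge> 1" using c by (cases s) (auto simp: in_pile_iff)
  have sum: "(\<Sum>l=1..s. b l) = (\<Sum>l=1..<s. b l) + b s"
    using s1 by (simp add: sum.last_plus)
  have sa: "s \<le> a"
  proof (rule ccontr)
    assume "\<not> s \<le> a"
    then have "b s = 0" using b by (auto simp: count_vectors_def)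
    with c sum show False by (simp add: in_pile_iff)
  qed
  have "(\<Sum>l=1..s. b l) \<le> (\<Sum>l=1..a. b l)"
    using sa by (intro sum_mono2) auto
  with b c n have "c \<le> n" by (auto simp: in_pile_iff count_vectors_def)
  with c s1 sa show ?thesis by (simp add: in_pile_iff)
qed

text \<open>
  The condition on the right forces \<open>\<gamma>\<close> to be a permutation of \<open>{2..n}\<close>: every entry has a
  pile number, and by the definition of \<open>count_vectors\<close> the piles partition \<open>{2..n}\<close>.
\<close>

lemma mem_interleavings_iff:
  assumes b: "b \<in> count_vectors a (n - 1)" and n: "n \<ge> 1"
  shows "\<gamma> \<in> interleavings a n b \<longleftrightarrow> (\<forall>s. filter (\<lambda>c. pile_index b c = s) \<gamma> = pile b s)"
    (is "_ \<longleftrightarrow> ?R")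
proof
  assume \<gamma>: "\<gamma> \<in> interleavings a n b"
  show ?R
  proof
    fix s
    have set: "set \<gamma> = {2..n}"
      using \<gamma> by (auto simp: interleavings_def permutations_of_set_def)
    have iff: "c \<in> set (pile b s) \<longleftrightarrow> pile_index b c = s" if "c \<in> set \<gamma>" for c
      using that in_pile_pile_index[of c b a] pile_index_eq[of c b s] b n unfolding set
      by (auto simp: count_vectors_def)
    show "filter (\<lambda>c. pile_index b c = s) \<gamma> = pile b s"
    proof (cases "s \<in> {1..a}")
      case True
      then have "filter (\<lambda>c. c \<in> set (pile b s)) \<gamma> = pile b s"
        using \<gamma> by (auto simp: interleavings_def)
      then show ?thesis using iff by (simp cong: filter_cong)
    next
      case False
      then have "c \<notin> set (pile b s)" for c
        using pile_bounds[OF b n, of c s] by auto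
      moreover from this have "pile b s = []"
        using last_in_set by blast
      ultimately show ?thesis using iff by (simp add: filter_empty_conv)
    qed
  qed
next
  assume R: ?R
  have cnt: "count (mset \<gamma>) c = count (mset (pile b (pile_index b c))) c" for c
    by (simp flip: R[rule_format] add: mset_filter)
  have mem: "c \<in> set \<gamma> \<longleftrightarrow> c \<in> set (pile b (pile_index b c))" for c
    using cnt[of c] by (metis count_eq_zero_iff set_mset_mset)
  have "set \<gamma> = {2..n}"
  proof (intro set_eqI iffI)
    fix c assume "c \<in> set \<gamma>"
    then show "c \<in> {2..n}" using mem pile_bounds[OF b n] by auto
  next
    fix c assume "c \<in> {2..n}"
    then show "c \<in> set \<gamma>"
      unfolding mem using b n by (intro in_pile_pile_index[of c b a]) (auto simp: count_vectors_def)
  qed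
  moreover have "distinct \<gamma>"
  proof -
    have "distinct (pile b s)" for s
      unfolding pile_def by (rule distinct_upt)
    then show ?thesis
      using cnt mem by (simp add: distinct_count_atmost_1)
  qed
  moreover have "filter (\<lambda>c. c \<in> set (pile b s)) \<gamma> = pile b s" for s
  proof -
    have "filter (\<lambda>c. c \<in> set (pile b s)) \<gamma> = filter (\<lambda>c. pile_index b c = s) \<gamma>"
    proof (rule filter_cong[OF refl])
      fix c assume "c \<in> set \<gamma>"
      then have "c \<in> set (pile b (pile_index b c))" by (simp only: mem)
      then show "c \<in> set (pile b s) \<longleftrightarrow> pile_index b c = s"
        by (auto dest: pile_index_eq simp del: set_upt)
    qed
    then show ?thesis using R by simp
  qed
  ultimately show "\<gamma> \<in> interleavings a n b"
    by (simp add: interleavings_def permutations_of_set_def)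
qed

lemma length_pile:
  assumes b: "b \<in> count_vectors a m"
  shows "length (pile b s) = b s"
proof (cases "s = 0")
  case True
  then show ?thesis using b by (simp add: pile_def count_vectors_def)
next
  case False
  then show ?thesis unfolding pile_def length_upt by (simp add: sum.last_plus)
qed

lemma count_image_mset_length: "count (image_mset f (mset xs)) s = length (filter (\<lambda>c. f c = s) xs)"
  by (induction xs) auto

text \<open>
  Replacing each card by its pile number identifies the interleavings with the words that have
  the prescribed letter counts.
\<close>

lemma bij_betw_interleavings_words:
  assumes b: "b \<in> count_vectors a (n - 1)" and n: "n \<ge> 1"
  shows "bij_betw (map (pile_index b)) (interleavings a n b) {w. count (mset w) = b}"
proof (rule bij_betw_imageI)
  show "inj_on (map (pile_index b)) (interleavings a n b)"
    by (rule inj_onI) (auto simp: mem_interleavings_iff[OF b n] intro: list_eq_by_labels)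
  show "map (pile_index b) ` interleavings a n b = {w. count (mset w) = b}"
  proof (intro subset_antisym subsetI)
    fix w assume "w \<in> map (pile_index b) ` interleavings a n b"
    then obtain \<gamma> where w: "w = map (pile_index b) \<gamma>"
      and \<gamma>: "\<And>s. filter (\<lambda>c. pile_index b c = s) \<gamma> = pile b s"
      by (auto simp: mem_interleavings_iff[OF b n])
    have "count (mset w) s = b s" for s
      using length_pile[OF b, of s] \<gamma>[of s] by (simp add: w count_image_mset_length)
    then show "w \<in> {w. count (mset w) = b}" by auto
  next
    fix w assume "w \<in> {w. count (mset w) = b}"
    then have "\<exists>\<gamma>. map (pile_index b) \<gamma> = w \<and> (\<forall>s. filter (\<lambda>c. pile_index b c = s) \<gamma> = pile b s)"
      by (intro merge_piles_along_word) (auto simp: length_pile[OF b] pile_index_eq)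
    then show "w \<in> map (pile_index b) ` interleavings a n b"
      by (auto simp: mem_interleavings_iff[OF b n])
  qed
qed

lemma sorted_wrt_filter_nth:
  assumes "sorted_wrt R (filter P xs)" "i < j" "j < length xs" "P (xs ! i)" "P (xs ! j)"
  shows "R (xs ! i) (xs ! j)"
proof -
  have "xs = take j xs @ drop j xs" by simp
  then have "sorted_wrt R (filter P (take j xs) @ filter P (drop j xs))"
    using assms(1) by (metis filter_append)
  moreover have "xs ! i \<in> set (filter P (take j xs))"
    using assms by (auto simp: in_set_conv_nth intro!: exI[of _ i])
  moreover have "xs ! j \<in> set (filter P (drop j xs))"
    using assms by (simp add: Cons_nth_drop_Suc[symmetric])
  ultimately show ?thesis by (auto simp: sorted_wrt_append)
qed

text \<open>
  Cards of different piles compare like their pile numbers, and of two cards of the same pile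
  the smaller comes first. So a card is smaller than an earlier one exactly if its pile number is.
\<close>

lemma num_lr_minima_interleaving:
  assumes b: "b \<in> count_vectors a (n - 1)" and n: "n \<ge> 1"
    and \<gamma>: "\<gamma> \<in> interleavings a n b"
  shows "num_lr_minima (map (pile_index b) \<gamma>) = num_lr_minima \<gamma>"
proof -
  have range: "c < 2 + (\<Sum>l=1..a. b l)" if "c \<in> set \<gamma>" for c
    using \<gamma> that b n by (auto simp: interleavings_def permutations_of_set_def count_vectors_def)
  have "pile_index b (\<gamma> ! j) < pile_index b (\<gamma> ! i) \<longleftrightarrow> \<gamma> ! j < \<gamma> ! i"
    if ij: "i < j" "j < length \<gamma>" for i j
  proof
    assume "pile_index b (\<gamma> ! j) < pile_index b (\<gamma> ! i)"
    then show "\<gamma> ! j < \<gamma> ! i"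
      using pile_index_mono[of "\<gamma> ! i" "\<gamma> ! j" b a] range[of "\<gamma> ! j"] ij by force
  next
    assume less: "\<gamma> ! j < \<gamma> ! i"
    have "pile_index b (\<gamma> ! j) \<noteq> pile_index b (\<gamma> ! i)"
    proof
      assume eq: "pile_index b (\<gamma> ! j) = pile_index b (\<gamma> ! i)"
      have "filter (\<lambda>c. pile_index b c = pile_index b (\<gamma> ! i)) \<gamma> = pile b (pile_index b (\<gamma> ! i))"
        using \<gamma> by (simp add: mem_interleavings_iff[OF b n])
      then have "sorted_wrt (<) (filter (\<lambda>c. pile_index b c = pile_index b (\<gamma> ! i)) \<gamma>)"
        unfolding pile_def by (simp only: sorted_wrt_upt)
      from sorted_wrt_filter_nth[OF this ij] eq less show False by simp
    qed
    moreover have "pile_index b (\<gamma> ! j) \<le> pile_index b (\<gamma> ! i)"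
      using pile_index_mono[of "\<gamma> ! j" "\<gamma> ! i" b a] range[of "\<gamma> ! i"] ij less by force
    ultimately show "pile_index b (\<gamma> ! j) < pile_index b (\<gamma> ! i)" by simp
  qed
  then show ?thesis
    unfolding num_lr_minima_def by (intro arg_cong[where f = card]) auto
qed

section \<open>Branches of trees given by parents\<close>

text \<open>
  The edge set on \<open>{1..n}\<close> in which each vertex \<open>i \<ge> 2\<close> is joined to \<open>f i\<close>.
\<close>

definition parent_edges :: "nat \<Rightarrow> (nat \<Rightarrow> nat) \<Rightarrow> nat set set" where
  "parent_edges n f = {{f i, i} | i. i \<in> {2..n}}"

text \<open>
  The maps giving each vertex \<open>i \<in> {2..n}\<close> a smaller parent. They are \<open>undefined\<close> off
  \<open>{2..n}\<close>, so that a map is determined by the parents that it assigns.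
\<close>

definition parent_maps :: "nat \<Rightarrow> (nat \<Rightarrow> nat) set" where
  "parent_maps n = PiE {2..n} (\<lambda>i. {1..<i})"

lemma branches_parent_edges:
  assumes "\<And>i. i \<in> {2..n} \<Longrightarrow> f i < i"
  shows "branches (parent_edges n f) = card {i \<in> {2..n}. f i = 1}"
proof -
  have "{e \<in> {{f i, i} | i. i \<in> {2..n}}. 1 \<in> e} = (\<lambda>i. {f i, i}) ` {i \<in> {2..n}. f i = 1}"
  proof (intro set_eqI iffI)
    fix e assume "e \<in> {e \<in> {{f i, i} | i. i \<in> {2..n}}. 1 \<in> e}"
    then obtain i where i: "i \<in> {2..n}" "e = {f i, i}" "1 \<in> e" by blast
    then have "f i = 1" by auto
    with i show "e \<in> (\<lambda>i. {f i, i}) ` {i \<in> {2..n}. f i = 1}" by blast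
  next
    fix e assume "e \<in> (\<lambda>i. {f i, i}) ` {i \<in> {2..n}. f i = 1}"
    then obtain i where "i \<in> {2..n}" "e = {f i, i}" "f i = 1" by auto
    then show "e \<in> {e \<in> {{f i, i} | i. i \<in> {2..n}}. 1 \<in> e}" by (auto intro!: exI[of _ i])
  qed
  moreover have "inj_on (\<lambda>i. {f i, i}) {i \<in> {2..n}. f i = 1}"
    by (rule inj_onI) (auto simp: doubleton_eq_iff)
  ultimately show ?thesis
    by (simp only: branches_def parent_edges_def card_image)
qed

lemma takeWhile_neq_nth:
  assumes "distinct xs" "j < length xs"
  shows "takeWhile (\<lambda>x. x \<noteq> xs ! j) xs = take j xs"
  using assms by (intro takeWhile_eq_take_P_nth) (auto simp: nth_eq_iff_index_eq)

lemma brt_parent_less: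
  assumes "i \<ge> 2"
  shows "brt_parent \<gamma> i < i"
proof -
  let ?js = "filter (\<lambda>j. j < i) (takeWhile (\<lambda>j. j \<noteq> i) \<gamma>)"
  have "last ?js \<in> set ?js" if "?js \<noteq> []" using that by (rule last_in_set)
  with assms show ?thesis by (auto simp: brt_parent_def Let_def)
qed

lemma brt_parent_eq_root_iff:
  assumes "distinct \<gamma>" "1 \<notin> set \<gamma>" "j < length \<gamma>"
  shows "brt_parent \<gamma> (\<gamma> ! j) = 1 \<longleftrightarrow> (\<forall>i<j. \<gamma> ! j < \<gamma> ! i)"
proof -
  let ?js = "filter (\<lambda>c. c < \<gamma> ! j) (take j \<gamma>)"
  have "last ?js \<noteq> 1" if "?js \<noteq> []"
    using last_in_set[OF that] assms(2) by (auto dest: in_set_takeD)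
  then have "brt_parent \<gamma> (\<gamma> ! j) = 1 \<longleftrightarrow> ?js = []"
    by (auto simp: brt_parent_def Let_def takeWhile_neq_nth assms)
  also have "\<dots> \<longleftrightarrow> (\<forall>i<j. \<not> \<gamma> ! i < \<gamma> ! j)"
    using assms(3) by (auto simp: filter_empty_conv all_set_conv_all_nth)
  also have "\<dots> \<longleftrightarrow> (\<forall>i<j. \<gamma> ! j < \<gamma> ! i)"
  proof -
    have "\<not> \<gamma> ! i < \<gamma> ! j \<longleftrightarrow> \<gamma> ! j < \<gamma> ! i" if "i < j" for i
    proof -
      have "\<gamma> ! i \<noteq> \<gamma> ! j"
        using assms that by (simp add: nth_eq_iff_index_eq)
      then show ?thesis by linarith
    qed
    then show ?thesis by blast
  qed
  finally show ?thesis .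
qed

lemma branches_brt:
  assumes "\<gamma> \<in> permutations_of_set {2..n}"
  shows "branches (parent_edges n (brt_parent \<gamma>)) = num_lr_minima \<gamma>"
proof -
  have \<gamma>: "distinct \<gamma>" "set \<gamma> = {2..n}"
    using assms by (auto simp: permutations_of_set_def)
  have root: "brt_parent \<gamma> (\<gamma> ! j) = 1 \<longleftrightarrow> (\<forall>i<j. \<gamma> ! j < \<gamma> ! i)" if "j < length \<gamma>" for j
    by (rule brt_parent_eq_root_iff[OF \<gamma>(1) _ that]) (simp add: \<gamma>(2))
  have eq: "{i \<in> {2..n}. brt_parent \<gamma> i = 1} =
      (!) \<gamma> ` {j. j < length \<gamma> \<and> (\<forall>i<j. \<gamma> ! j < \<gamma> ! i)}"
    (is "?L = ?R")
  proof (intro set_eqI iffI)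
    fix i assume i: "i \<in> ?L"
    then have "i \<in> set \<gamma>" using \<gamma>(2) by simp
    then obtain j where j: "j < length \<gamma>" "i = \<gamma> ! j"
      by (auto simp: in_set_conv_nth)
    with i root[OF j(1)] show "i \<in> ?R" by blast
  next
    fix i assume "i \<in> ?R"
    then obtain j where j: "j < length \<gamma>" "i = \<gamma> ! j" "\<forall>i<j. \<gamma> ! j < \<gamma> ! i"
      by blast
    then have "i \<in> {2..n}" using \<gamma>(2) nth_mem by blast
    with j root[OF j(1)] show "i \<in> ?L" by blast
  qed
  have "inj_on ((!) \<gamma>) {j. j < length \<gamma> \<and> (\<forall>i<j. \<gamma> ! j < \<gamma> ! i)}"
    using \<gamma>(1) by (auto intro!: inj_onI simp: nth_eq_iff_index_eq)
  moreover have "branches (parent_edges n (brt_parent \<gamma>)) = card {i \<in> {2..n}. brt_parent \<gamma> i = 1}"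
    by (rule branches_parent_edges) (simp add: brt_parent_less)
  ultimately show ?thesis
    by (simp only: eq card_image num_lr_minima_def)
qed

text \<open>
  Given the pile sizes \<open>b\<close>, all words with letter counts \<open>b\<close> are equally likely, and
  the multinomial distribution of \<open>b\<close> makes the letters independent with distribution \<open>p\<close>.
\<close>

lemma expected_branches_brt_words:
  assumes p: "prob_vector a p" and n: "n \<ge> 1"
  shows "expected_branches (brt a p n) =
     (\<Sum>w\<in>words {1..a} (n - 1). prod_list (map p w) * real (num_lr_minima w))"
proof -
  let ?M = "multinomial_pmf a p (n - 1)" and ?B = "count_vectors a (n - 1)"
  let ?h = "\<lambda>\<gamma>. real (branches (parent_edges n (brt_parent \<gamma>)))"
  have inter: "interleavings a n b \<noteq> {} \<and> finite (interleavings a n b) \<and>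
      card (interleavings a n b) = card {w. count (mset w) = b}" if b: "b \<in> ?B" for b
  proof -
    have bij: "bij_betw (map (pile_index b)) (interleavings a n b) {w. count (mset w) = b}"
      by (rule bij_betw_interleavings_words[OF b n])
    obtain w where "count (mset w) = b" by (rule ex_word_of_count_vector[OF b])
    then have "interleavings a n b \<noteq> {}"
      using bij by (auto simp: bij_betw_def)
    moreover have "finite (interleavings a n b)"
      unfolding interleavings_def by simp
    ultimately show ?thesis using bij_betw_same_card[OF bij] by simp
  qed
  have fiber: "(\<Sum>\<gamma>\<in>interleavings a n b. ?h \<gamma>) = (\<Sum>w | count (mset w) = b. real (num_lr_minima w))"
    if b: "b \<in> ?B" for b
  proof -
    have "(\<Sum>\<gamma>\<in>interleavings a n b. ?h \<gamma>) =
        (\<Sum>\<gamma>\<in>interleavings a n b. real (num_lr_minima (map (pile_index b) \<gamma>)))"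
    proof (rule sum.cong[OF refl])
      fix \<gamma> assume \<gamma>: "\<gamma> \<in> interleavings a n b"
      then show "?h \<gamma> = real (num_lr_minima (map (pile_index b) \<gamma>))"
        unfolding num_lr_minima_interleaving[OF b n \<gamma>]
        by (subst branches_brt) (auto simp: interleavings_def)
    qed
    also have "\<dots> = (\<Sum>w | count (mset w) = b. real (num_lr_minima w))"
      by (rule sum.reindex_bij_betw[OF bij_betw_interleavings_words[OF b n]])
    finally show ?thesis .
  qed
  have supp: "set_pmf ?M \<subseteq> ?B"
    by (auto simp: set_pmf_eq pmf_multinomial[OF p])
  have "expected_branches (brt a p n) = measure_pmf.expectation (riffle_pmf a p n) ?h"
    by (simp add: expected_branches_def brt_def parent_edges_def)
  also have "\<dots> = (\<Sum>b\<in>?B. pmf ?M b *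
      measure_pmf.expectation (pmf_of_set (interleavings a n b)) ?h)"
    unfolding riffle_pmf_def
    by (subst pmf_expectation_bind[OF finite_count_vectors _ supp]) (auto simp: inter)
  also have "\<dots> = (\<Sum>b\<in>?B. (\<Prod>s=1..a. p s ^ b s) * (\<Sum>w | count (mset w) = b. real (num_lr_minima w)))"
  proof (rule sum.cong[OF refl])
    fix b assume b: "b \<in> ?B"
    note card = card_words_of_count[OF b]
    have pos: "real (card {w. count (mset w) = b}) \<noteq> 0"
      unfolding card by simp
    have "pmf ?M b = real (card {w. count (mset w) = b}) * (\<Prod>s=1..a. p s ^ b s)"
      using b by (simp add: pmf_multinomial[OF p] card)
    moreover have "measure_pmf.expectation (pmf_of_set (interleavings a n b)) ?h =
      (\<Sum>w | count (mset w) = b. real (num_lr_minima w)) / real (card {w. count (mset w) = b})"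
      using inter[OF b] fiber[OF b] by (simp add: integral_pmf_of_set)
    ultimately show "pmf ?M b * measure_pmf.expectation (pmf_of_set (interleavings a n b)) ?h =
      (\<Prod>s=1..a. p s ^ b s) * (\<Sum>w | count (mset w) = b. real (num_lr_minima w))"
      using pos by simp
  qed
  finally show ?thesis
    by (simp only: sum_words_weight_by_count)
qed

section \<open>Attaching a leaf to a tree\<close>

lemma is_path_append:
  "xs \<noteq> [] \<Longrightarrow> ys \<noteq> [] \<Longrightarrow> is_path E (xs @ ys) \<longleftrightarrow>
     is_path E xs \<and> is_path E ys \<and> set xs \<inter> set ys = {} \<and> {last xs, hd ys} \<in> E"
  by (auto simp: is_path_def successively_append_iff)

lemma is_path_rev: "is_path E (rev xs) \<longleftrightarrow> is_path E xs"
  by (simp add: is_path_def successively_rev insert_commute)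

lemma is_path_mono: "is_path E xs \<Longrightarrow> E \<subseteq> F \<Longrightarrow> is_path F xs"
  by (auto simp: is_path_def intro: successively_mono)

lemma set_path_subset:
  assumes "is_path E xs" "\<Union>E \<subseteq> V" "hd xs \<in> V"
  shows "set xs \<subseteq> V"
  using assms
proof (induction xs rule: rev_induct)
  case Nil
  then show ?case by simp
next
  case (snoc x xs)
  then show ?case
    by (cases "xs = []") (auto simp: is_path_append)
qed

lemma is_path_insert_leaf:
  assumes "\<Union>E \<subseteq> V" "v \<notin> V" "u \<in> V" "v \<notin> set xs"
  shows "is_path (insert {u, v} E) xs \<longleftrightarrow> is_path E xs"
proof -
  have "successively (\<lambda>x y. {x, y} \<in> insert {u, v} E) xs \<longleftrightarrow> successively (\<lambda>x y. {x, y} \<in> E) xs"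
    using assms(4) by (intro successively_cong) (auto simp: doubleton_eq_iff)
  then show ?thesis by (simp add: is_path_def)
qed

text \<open>
  The leaf \<open>v\<close> has the single neighbour \<open>u\<close>, so a path can meet \<open>v\<close> only at its ends.
\<close>

lemma path_to_leaf:
  assumes E: "\<Union>E \<subseteq> V" "v \<notin> V" "u \<in> V"
    and xs: "is_path (insert {u, v} E) xs" "v \<in> set xs" "hd xs \<noteq> v"
  obtains ys where "xs = ys @ [v]" "is_path E ys" "last ys = u" "hd ys = hd xs" "v \<notin> set ys"
proof -
  let ?F = "insert {u, v} E"
  obtain ys zs where split: "xs = ys @ v # zs"
    using xs(2) by (meson split_list)
  have ys: "ys \<noteq> []" using split xs(3) by auto
  have nbr: "x = u" if "{x, v} \<in> ?F" for x
    using that E by (auto simp: doubleton_eq_iff)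
  have p: "is_path ?F ys" "is_path ?F (v # zs)" "set ys \<inter> set (v # zs) = {}" "{last ys, v} \<in> ?F"
    using xs(1) ys unfolding split by (auto simp: is_path_append)
  have "last ys = u" using nbr p(4) by simp
  have "zs = []"
  proof (rule ccontr)
    assume zs: "zs \<noteq> []"
    have "is_path ?F ([v] @ zs)" using p(2) by simp
    then have "{v, hd zs} \<in> ?F"
      using zs by (subst (asm) is_path_append) auto
    then have "hd zs = u" using nbr[of "hd zs"] by (simp add: insert_commute)
    with \<open>last ys = u\<close> p(3) ys zs show False
      by (metis disjoint_iff hd_in_set last_in_set list.set_intros(2))
  qed
  moreover have "v \<notin> set ys" using p(3) by auto
  ultimately show ?thesis
    using that[of ys] split p(1) ys \<open>last ys = u\<close> is_path_insert_leaf[OF E] by simp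
qed

lemma is_tree_edges: "is_tree V E \<Longrightarrow> \<Union>E \<subseteq> V"
proof
  fix x assume T: "is_tree V E" and "x \<in> \<Union>E"
  then obtain e where e: "e \<in> E" "x \<in> e" by blast
  have "E \<subseteq> {{u, v} | u v. u \<in> V \<and> v \<in> V \<and> u \<noteq> v}"
    using T by (simp only: is_tree_def)
  with e(1) obtain u v where "e = {u, v}" "u \<in> V" "v \<in> V" by blast
  with e(2) show "x \<in> V" by blast
qed

lemma is_tree_insert_leaf:
  assumes T: "is_tree V E" and v: "v \<notin> V" and u: "u \<in> V"
  shows "is_tree (insert v V) (insert {u, v} E)"
proof -
  let ?F = "insert {u, v} E"
  note E = is_tree_edges[OF T] v u
  have uniq: "\<exists>!xs. is_path E xs \<and> hd xs = x \<and> last xs = y" if "x \<in> V" "y \<in> V" for x y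
    using T that by (simp add: is_tree_def)
  have avoid: "v \<notin> set xs" if "is_path E xs" "hd xs \<in> V" for xs
    using set_path_subset[OF that(1) E(1) that(2)] v by auto
  have VV: "\<exists>!xs. is_path ?F xs \<and> hd xs = x \<and> last xs = y" if xy: "x \<in> V" "y \<in> V" for x y
  proof -
    have "is_path ?F xs \<and> hd xs = x \<and> last xs = y \<longleftrightarrow> is_path E xs \<and> hd xs = x \<and> last xs = y" for xs
    proof (cases "v \<in> set xs")
      case True
      have "\<not> (is_path ?F xs \<and> hd xs = x \<and> last xs = y)"
        using path_to_leaf[OF E _ True] xy v by (metis last_snoc)
      moreover have "\<not> (is_path E xs \<and> hd xs = x)"
        using avoid True xy by auto
      ultimately show ?thesis by blast
    qed (simp add: is_path_insert_leaf[OF E])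
    then show ?thesis using uniq[OF xy] by simp
  qed
  have Vv: "\<exists>!xs. is_path ?F xs \<and> hd xs = x \<and> last xs = v" if x: "x \<in> V" for x
  proof -
    obtain ys where ys: "is_path E ys" "hd ys = x" "last ys = u"
      and ys_uniq: "\<And>zs. is_path E zs \<Longrightarrow> hd zs = x \<Longrightarrow> last zs = u \<Longrightarrow> zs = ys"
      using uniq[OF x u] by blast
    have ne: "ys \<noteq> []" using ys by (auto simp: is_path_def)
    show ?thesis
    proof (rule ex1I[of _ "ys @ [v]"])
      have "is_path ?F ys" using ys(1) by (rule is_path_mono) auto
      then show "is_path ?F (ys @ [v]) \<and> hd (ys @ [v]) = x \<and> last (ys @ [v]) = v"
        using ne ys avoid[OF ys(1)] x by (simp add: is_path_append) (simp add: is_path_def)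
    next
      fix xs assume xs: "is_path ?F xs \<and> hd xs = x \<and> last xs = v"
      then have "v \<in> set xs" by (metis is_path_def last_in_set)
      moreover have "hd xs \<noteq> v" using xs x v by auto
      ultimately obtain zs where "xs = zs @ [v]" "is_path E zs" "last zs = u" "hd zs = hd xs"
        using path_to_leaf[OF E, of xs] xs by blast
      with xs ys_uniq[of zs] show "xs = ys @ [v]" by simp
    qed
  qed
  have vV: "\<exists>!xs. is_path ?F xs \<and> hd xs = v \<and> last xs = x" if x: "x \<in> V" for x
  proof -
    obtain ys where ys: "is_path ?F ys" "hd ys = x" "last ys = v"
      and ys_uniq: "\<And>zs. is_path ?F zs \<Longrightarrow> hd zs = x \<Longrightarrow> last zs = v \<Longrightarrow> zs = ys"
      using Vv[OF x] by blast
    show ?thesis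
    proof (rule ex1I[of _ "rev ys"])
      show "is_path ?F (rev ys) \<and> hd (rev ys) = v \<and> last (rev ys) = x"
        using ys by (auto simp: is_path_rev hd_rev last_rev)
    next
      fix xs assume "is_path ?F xs \<and> hd xs = v \<and> last xs = x"
      then have "rev xs = ys"
        by (intro ys_uniq) (auto simp: is_path_rev hd_rev last_rev)
      then show "xs = rev ys" by auto
    qed
  qed
  have vv: "\<exists>!xs. is_path ?F xs \<and> hd xs = v \<and> last xs = v"
  proof (rule ex1I[of _ "[v]"])
    show "is_path ?F [v] \<and> hd [v] = v \<and> last [v] = v" by (simp add: is_path_def)
  next
    fix xs assume "is_path ?F xs \<and> hd xs = v \<and> last xs = v"
    then show "xs = [v]"
      by (cases xs) (auto simp: is_path_def split: if_splits)
  qed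
  have F_edges: "?F \<subseteq> {{x, y} | x y. x \<in> insert v V \<and> y \<in> insert v V \<and> x \<noteq> y}"
  proof
    fix e assume "e \<in> ?F"
    then consider "e = {u, v}" | x y where "e = {x, y}" "x \<in> V" "y \<in> V" "x \<noteq> y"
      using T unfolding is_tree_def by blast
    then show "e \<in> {{x, y} | x y. x \<in> insert v V \<and> y \<in> insert v V \<and> x \<noteq> y}"
      using u v by cases blast+
  qed
  have F_paths: "\<exists>!xs. is_path ?F xs \<and> hd xs = x \<and> last xs = y"
    if "x \<in> insert v V" "y \<in> insert v V" for x y
    using that VV[of x y] Vv[of x] vV[of y] vv by (cases "x = v"; cases "y = v") simp_all
  show ?thesis
    unfolding is_tree_def by (intro conjI ballI insert_not_empty F_edges F_paths)
qed

section \<open>Increasing trees and parent maps\<close>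

text \<open>
  The largest vertex has no children, so the tree grows by attaching \<open>2, ..., n\<close> in turn as leaves.
\<close>

lemma parent_edges_increasing:
  assumes n: "n \<ge> 1" and "\<And>i. i \<in> {2..n} \<Longrightarrow> f i \<in> {1..<i}"
  shows "parent_edges n f \<in> increasing_trees n"
  using assms
proof (induction n rule: nat_induct_at_least)
  case base
  have "xs = [1] \<longleftrightarrow> is_path {} xs \<and> hd xs = (1::nat) \<and> last xs = 1" for xs
    by (cases xs) (auto simp: is_path_def successively_Cons)
  then have "is_tree {1..1::nat} {}"
    by (simp add: is_tree_def) metis
  moreover have "is_path {} xs \<Longrightarrow> sorted_wrt (<) xs" for xs :: "nat list"
    by (cases xs) (auto simp: is_path_def successively_Cons)
  ultimately show ?case by (simp add: increasing_trees_def parent_edges_def)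
next
  case (Suc n)
  let ?E = "parent_edges n f" and ?v = "Suc n"
  have IH: "?E \<in> increasing_trees n"
    using Suc by auto
  then have T: "is_tree {1..n} ?E"
    and inc: "\<And>xs. is_path ?E xs \<Longrightarrow> hd xs = 1 \<Longrightarrow> sorted_wrt (<) xs"
    by (auto simp: increasing_trees_def)
  have f: "f ?v \<in> {1..n}" using Suc.prems[of "?v"] Suc.hyps by auto
  have F: "parent_edges ?v f = insert {f ?v, ?v} ?E"
  proof -
    have "{2..?v} = insert ?v {2..n}" using Suc.hyps by auto
    then show ?thesis by (simp only: parent_edges_def setcompr_eq_image Collect_mem_eq image_insert)
  qed
  have V: "{1..?v} = insert ?v {1..n}" by auto
  have v: "?v \<notin> {1..n}" by simp
  note E = is_tree_edges[OF T] v f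
  have "is_tree {1..?v} (parent_edges ?v f)"
    unfolding F V by (rule is_tree_insert_leaf[OF T v f])
  moreover have "sorted_wrt (<) xs"
    if xs: "is_path (parent_edges ?v f) xs" "hd xs = 1" for xs
  proof (cases "?v \<in> set xs")
    case True
    moreover have "hd xs \<noteq> ?v" using xs Suc.hyps by simp
    ultimately obtain ys where ys: "xs = ys @ [?v]" "is_path ?E ys" "hd ys = hd xs"
      using path_to_leaf[OF E, of xs] xs unfolding F by blast
    have "set ys \<subseteq> {1..n}"
      using set_path_subset[OF ys(2) E(1)] ys(3) xs(2) Suc.hyps by simp
    with inc[OF ys(2)] ys xs show ?thesis by (auto simp: sorted_wrt_append)
  next
    case False
    then show ?thesis using xs inc is_path_insert_leaf[OF E False] unfolding F by simp
  qed
  ultimately show ?case by (simp add: increasing_trees_def)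
qed

text \<open>
  The parent of \<open>v\<close> is the vertex before \<open>v\<close> on the path from the root to \<open>v\<close>.
\<close>

lemma increasing_tree_parent_edges:
  assumes n: "n \<ge> 1" and E: "E \<in> increasing_trees n"
  shows "\<exists>f\<in>parent_maps n. E = parent_edges n f"
proof -
  have T: "is_tree {1..n} E"
    and inc: "\<And>xs. is_path E xs \<Longrightarrow> hd xs = 1 \<Longrightarrow> sorted_wrt (<) xs"
    using E by (auto simp: increasing_trees_def)
  have uniq: "\<exists>!xs. is_path E xs \<and> hd xs = 1 \<and> last xs = v" if "v \<in> {1..n}" for v
    using T n that by (simp add: is_tree_def)
  have "\<exists>ys. is_path E (ys @ [v]) \<and> ys \<noteq> [] \<and> hd ys = 1 \<and> last ys \<in> {1..<v} \<and> {last ys, v} \<in> E"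
    if v: "v \<in> {2..n}" for v
  proof -
    obtain xs where xs: "is_path E xs" "hd xs = 1" "last xs = v"
      using uniq[of v] v by auto
    then have "xs \<noteq> []" by (simp add: is_path_def)
    then obtain ys where ys: "xs = ys @ [v]"
      using xs(3) by (metis append_butlast_last_id)
    have ne: "ys \<noteq> []" using xs v ys by auto
    have "set xs \<subseteq> {1..n}"
      using set_path_subset[OF xs(1) is_tree_edges[OF T]] xs(2) n by simp
    then have "set ys \<subseteq> {1..n}" using ys by simp
    then have "1 \<le> last ys" using last_in_set[OF ne] by auto
    moreover have "last ys < v"
      using inc[OF xs(1,2)] ne unfolding ys by (simp add: sorted_wrt_append)
    moreover have "{last ys, v} \<in> E"
      using xs(1) ne unfolding ys by (simp add: is_path_append)
    ultimately show ?thesis using xs ys ne by (intro exI[of _ ys]) auto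
  qed
  then obtain Y where Y: "\<And>v. v \<in> {2..n} \<Longrightarrow> is_path E (Y v @ [v]) \<and> Y v \<noteq> [] \<and> hd (Y v) = 1 \<and>
      last (Y v) \<in> {1..<v} \<and> {last (Y v), v} \<in> E"
    by metis
  define f where "f v = last (Y v)" for v
  have f: "is_path E (Y v @ [v]) \<and> Y v \<noteq> [] \<and> hd (Y v) = 1 \<and>
      last (Y v) = f v \<and> f v \<in> {1..<v} \<and> {f v, v} \<in> E" if "v \<in> {2..n}" for v
    using Y[OF that] by (simp add: f_def)
  have edge: "{u, v} \<in> parent_edges n f" if uv: "{u, v} \<in> E" "u < v" for u v
  proof -
    \<comment> \<open>The path to \<open>u\<close> increases, so it avoids \<open>v\<close> and extends by \<open>v\<close> to the path to \<open>v\<close>.\<close>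
    have V: "u \<in> {1..n}" "v \<in> {1..n}" using is_tree_edges[OF T] uv by auto
    obtain xs where xs: "is_path E xs" "hd xs = 1" "last xs = u"
      using uniq[OF V(1)] by auto
    have ne: "xs \<noteq> []" using xs by (simp add: is_path_def)
    then have xs_snoc: "xs = butlast xs @ [u]" using xs(3) by (metis append_butlast_last_id)
    have "sorted_wrt (<) (butlast xs @ [u])" using inc[OF xs(1,2)] xs_snoc by simp
    then have "x \<le> u" if "x \<in> set (butlast xs @ [u])" for x
      using that by (auto simp: sorted_wrt_append)
    then have "v \<notin> set xs" using xs_snoc uv(2) by force
    then have p: "is_path E (xs @ [v])"
      using xs ne uv by (simp add: is_path_append) (simp add: is_path_def)
    have v2: "v \<in> {2..n}" using V uv(2) by auto
    have "xs @ [v] = Y v @ [v]"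
      using uniq[OF V(2)] p f[OF v2] ne xs(2) by (metis hd_append2 last_snoc)
    then have "f v = u" using f[OF v2] xs(3) by auto
    then show ?thesis using v2 by (auto simp: parent_edges_def)
  qed
  have "E = parent_edges n f"
  proof (intro subset_antisym subsetI)
    fix e assume e: "e \<in> E"
    then obtain u v where "e = {u, v}" "u \<noteq> v"
      using T unfolding is_tree_def by blast
    then show "e \<in> parent_edges n f"
      using edge[of u v] edge[of v u] e by (cases "u < v") (auto simp: insert_commute)
  next
    fix e assume "e \<in> parent_edges n f"
    then show "e \<in> E" using f by (auto simp: parent_edges_def)
  qed
  also have "\<dots> = parent_edges n (restrict f {2..n})"
    by (auto simp: parent_edges_def)
  finally have "E = parent_edges n (restrict f {2..n})" .
  moreover have "restrict f {2..n} \<in> parent_maps n"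
    using f by (auto simp: parent_maps_def)
  ultimately show ?thesis by blast
qed

lemma increasing_trees_eq:
  assumes "n \<ge> 1"
  shows "increasing_trees n = parent_edges n ` parent_maps n"
proof (intro subset_antisym subsetI)
  fix E assume "E \<in> increasing_trees n"
  then show "E \<in> parent_edges n ` parent_maps n"
    using increasing_tree_parent_edges[OF assms] by blast
next
  fix E assume "E \<in> parent_edges n ` parent_maps n"
  then obtain f where f: "f \<in> parent_maps n" and E: "E = parent_edges n f" by blast
  show "E \<in> increasing_trees n"
    unfolding E by (rule parent_edges_increasing[OF assms])
      (use f in \<open>simp only: parent_maps_def PiE_mem\<close>)
qed

lemma inj_on_parent_edges: "inj_on (parent_edges n) (parent_maps n)"
proof (rule inj_onI)
  fix f g assume f: "f \<in> parent_maps n" and g: "g \<in> parent_maps n"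
    and eq: "parent_edges n f = parent_edges n g"
  show "f = g"
  proof (rule PiE_ext[of _ "{2..n}"])
    fix i assume i: "i \<in> {2..n}"
    then have "{f i, i} \<in> parent_edges n g"
      unfolding eq[symmetric] by (auto simp: parent_edges_def)
    then obtain j where j: "j \<in> {2..n}" "{f i, i} = {g j, j}"
      by (auto simp: parent_edges_def)
    have "f i < i" "g j < j"
      using PiE_mem[OF f[unfolded parent_maps_def] i] PiE_mem[OF g[unfolded parent_maps_def] j(1)]
      by auto
    with j show "f i = g i" by (auto simp: doubleton_eq_iff)
  qed (use f g in \<open>auto simp: parent_maps_def\<close>)
qed

lemma finite_parent_maps: "finite (parent_maps n)"
  unfolding parent_maps_def by (intro finite_PiE) auto

lemma card_parent_maps: "card (parent_maps n) = (\<Prod>k=2..n. k - 1)"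
  unfolding parent_maps_def by (simp add: card_PiE)

text \<open>
  Requiring that \<open>i\<close> be attached to the root replaces \<open>i - 1\<close> choices by one and leaves the
  parents of the other vertices free.
\<close>

lemma card_parent_maps_root:
  assumes i: "i \<in> {2..n}"
  shows "real (card {f \<in> parent_maps n. f i = 1}) = real (card (parent_maps n)) / real (i - 1)"
proof -
  have "{f \<in> parent_maps n. f i = 1} = PiE {2..n} (\<lambda>k. if k = i then {1} else {1..<k})"
  proof (intro set_eqI iffI)
    fix f assume "f \<in> {f \<in> parent_maps n. f i = 1}"
    then show "f \<in> PiE {2..n} (\<lambda>k. if k = i then {1} else {1..<k})"
      by (simp add: parent_maps_def PiE_iff)
  next
    fix f assume f: "f \<in> PiE {2..n} (\<lambda>k. if k = i then {1} else {1..<k})"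
    then have fi: "f i = 1" using PiE_mem[OF f i] by simp
    have "f k \<in> {1..<k}" if "k \<in> {2..n}" for k
      using PiE_mem[OF f that] i fi by (cases "k = i") auto
    then show "f \<in> {f \<in> parent_maps n. f i = 1}"
      using f fi by (simp add: parent_maps_def PiE_iff)
  qed
  then have "card {f \<in> parent_maps n. f i = 1} = (\<Prod>k=2..n. if k = i then 1 else k - 1)"
    by (auto simp: card_PiE intro!: prod.cong)
  also have "\<dots> = (\<Prod>k\<in>{2..n} - {i}. k - 1)"
    using i by (subst prod.remove[of _ i]) (auto intro!: prod.cong)
  finally have "card (parent_maps n) = (i - 1) * card {f \<in> parent_maps n. f i = 1}"
    using i by (simp add: card_parent_maps prod.remove[of "{2..n}" i])
  then have "real (card (parent_maps n)) = real (i - 1) * real (card {f \<in> parent_maps n. f i = 1})"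
    by (simp only: of_nat_mult)
  moreover have "real (i - 1) \<noteq> 0" using i by simp
  ultimately show ?thesis by (simp only: nonzero_mult_div_cancel_left not_False_eq_True)
qed

lemma expected_branches_urt:
  assumes n: "n \<ge> 1"
  shows "expected_branches (urt n) = harm (n - 1)"
proof -
  let ?F = "parent_maps n"
  have pos: "card ?F > 0"
    unfolding card_parent_maps by (rule prod_pos) auto
  then have ne: "?F \<noteq> {}" by auto
  have "urt n = map_pmf (parent_edges n) (pmf_of_set ?F)"
    unfolding urt_def increasing_trees_eq[OF n]
    by (rule map_pmf_of_set_inj[OF inj_on_parent_edges ne finite_parent_maps, symmetric])
  then have "expected_branches (urt n) = (\<Sum>f\<in>?F. real (branches (parent_edges n f))) / real (card ?F)"
    by (simp add: expected_branches_def integral_pmf_of_set ne finite_parent_maps)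
  also have "(\<Sum>f\<in>?F. real (branches (parent_edges n f))) =
      (\<Sum>f\<in>?F. \<Sum>i=2..n. if f i = 1 then 1 else 0)"
  proof (rule sum.cong[OF refl])
    fix f assume "f \<in> ?F"
    then have "\<And>i. i \<in> {2..n} \<Longrightarrow> f i < i"
      unfolding parent_maps_def by (auto dest: PiE_mem)
    then have "branches (parent_edges n f) = card {i \<in> {2..n}. f i = 1}"
      by (rule branches_parent_edges)
    then show "real (branches (parent_edges n f)) = (\<Sum>i=2..n. if f i = 1 then 1 else 0)"
      by (simp add: sum.If_cases Int_def)
  qed
  also have "\<dots> = (\<Sum>i=2..n. real (card {f \<in> ?F. f i = 1}))"
    by (subst sum.swap) (simp add: sum.If_cases finite_parent_maps Int_def)
  also have "\<dots> / real (card ?F) = (\<Sum>i=2..n. 1 / real (i - 1))"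
    unfolding sum_divide_distrib using pos by (intro sum.cong refl) (subst card_parent_maps_root, auto)
  also have "\<dots> = harm (n - 1)"
    unfolding harm_def
    by (rule sum.reindex_bij_witness[of _ Suc "\<lambda>i. i - 1"]) (auto simp: field_simps)
  finally show ?thesis .
qed

section \<open>Sums of powers and a Riemann sum\<close>

lemma one_minus_times_geometric_sum:
  fixes x :: real
  shows "(1 - x) * (\<Sum>j<m. x ^ j) = 1 - x ^ m"
  by (simp add: sum_gp_strict)

text \<open>
  Both bounds sum the estimate of the difference of consecutive \<open>(k+1)\<close>-st powers between
  \<open>(k+1) s^k\<close> and \<open>(k+1) (s+1)^k\<close>.
\<close>

lemma sum_power_bounds:
  "real (k + 1) * (\<Sum>s<a. real s ^ k) \<le> real a ^ (k + 1)"
  "real a ^ (k + 1) \<le> real (k + 1) * (\<Sum>s<a. real (Suc s) ^ k)"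
proof -
  have step: "real (k + 1) * real s ^ k \<le> real (Suc s) ^ (k + 1) - real s ^ (k + 1)"
    "real (Suc s) ^ (k + 1) - real s ^ (k + 1) \<le> real (k + 1) * real (Suc s) ^ k" for s
  proof -
    have eq: "real (Suc s) ^ (k + 1) - real s ^ (k + 1) = (\<Sum>i\<le>k. real (Suc s) ^ i * real s ^ (k - i))"
      using power_diff_sumr2[of "real (Suc s)" "k + 1" "real s"]
      by (simp add: lessThan_Suc_atMost mult.commute)
    have "(\<Sum>i\<le>k. real s ^ k) \<le> (\<Sum>i\<le>k. real (Suc s) ^ i * real s ^ (k - i))"
    proof (rule sum_mono)
      fix i assume "i \<in> {..k}"
      then have "real s ^ k = real s ^ i * real s ^ (k - i)"
        by (simp flip: power_add)
      also have "\<dots> \<le> real (Suc s) ^ i * real s ^ (k - i)"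
        by (intro mult_right_mono power_mono) auto
      finally show "real s ^ k \<le> real (Suc s) ^ i * real s ^ (k - i)" .
    qed
    then show "real (k + 1) * real s ^ k \<le> real (Suc s) ^ (k + 1) - real s ^ (k + 1)"
      unfolding eq by simp
    have "(\<Sum>i\<le>k. real (Suc s) ^ i * real s ^ (k - i)) \<le> (\<Sum>i\<le>k. real (Suc s) ^ k)"
    proof (rule sum_mono)
      fix i assume "i \<in> {..k}"
      then have "real (Suc s) ^ k = real (Suc s) ^ i * real (Suc s) ^ (k - i)"
        by (simp flip: power_add)
      moreover have "real (Suc s) ^ i * real s ^ (k - i) \<le> real (Suc s) ^ i * real (Suc s) ^ (k - i)"
        by (intro mult_left_mono power_mono) auto
      ultimately show "real (Suc s) ^ i * real s ^ (k - i) \<le> real (Suc s) ^ k" by simp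
    qed
    then show "real (Suc s) ^ (k + 1) - real s ^ (k + 1) \<le> real (k + 1) * real (Suc s) ^ k"
      unfolding eq by simp
  qed
  have tel: "(\<Sum>s<a. real (Suc s) ^ (k + 1) - real s ^ (k + 1)) = real a ^ (k + 1)"
    by (subst sum_lessThan_telescope) simp
  show "real (k + 1) * (\<Sum>s<a. real s ^ k) \<le> real a ^ (k + 1)"
    unfolding tel[symmetric] sum_distrib_left by (intro sum_mono step)
  show "real a ^ (k + 1) \<le> real (k + 1) * (\<Sum>s<a. real (Suc s) ^ k)"
    unfolding tel[symmetric] sum_distrib_left by (intro sum_mono step)
qed

lemma power_sum_asymptotics:
  "(\<lambda>a. (\<Sum>s<a. (real s / real a) ^ k) / real a) \<longlonglongrightarrow> 1 / real (k + 1)"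
proof (rule tendsto_sandwich)
  let ?f = "\<lambda>a. (\<Sum>s<a. (real s / real a) ^ k) / real a"
  have f: "?f a = (\<Sum>s<a. real s ^ k) / real a ^ (k + 1)" for a
    by (simp add: power_divide sum_divide_distrib mult.commute)
  show "\<forall>\<^sub>F a in sequentially. ?f a \<le> 1 / real (k + 1)"
    using eventually_gt_at_top[of 0]
  proof eventually_elim
    case (elim a)
    have "0 < real a ^ (k + 1)" using elim by simp
    with sum_power_bounds(1)[where k = k and a = a] show ?case
      unfolding f by (simp add: pos_divide_le_eq pos_le_divide_eq mult.commute del: power_Suc)
  qed
  show "\<forall>\<^sub>F a in sequentially. 1 / real (k + 1) - 1 / real a \<le> ?f a"
    using eventually_gt_at_top[of 0]
  proof eventually_elim
    case (elim a)
    have pos: "0 < real a ^ (k + 1)" using elim by simp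
    have "(\<Sum>s<a. real (Suc s) ^ k) = (\<Sum>s<a. real s ^ k) + (real a ^ k - 0 ^ k)"
      using sum_lessThan_telescope[of "\<lambda>s. real s ^ k" a] by (simp add: sum_subtractf)
    also have "\<dots> \<le> (\<Sum>s<a. real s ^ k) + real a ^ k" by simp
    finally have "real a ^ (k + 1) / real (k + 1) \<le> (\<Sum>s<a. real s ^ k) + real a ^ k"
    proof (rule order_trans[rotated])
      have "real a ^ (k + 1) \<le> (\<Sum>s<a. real (Suc s) ^ k) * real (k + 1)"
        using sum_power_bounds(2)[of a k] by (simp only: mult.commute)
      then show "real a ^ (k + 1) / real (k + 1) \<le> (\<Sum>s<a. real (Suc s) ^ k)"
        by (subst pos_divide_le_eq) simp_all
    qed
    then have "(real a ^ (k + 1) / real (k + 1) - real a ^ k) / real a ^ (k + 1) \<le> ?f a"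
      unfolding f using pos by (intro divide_right_mono) auto
    moreover have "(real a ^ (k + 1) / real (k + 1) - real a ^ k) / real a ^ (k + 1) =
        1 / real (k + 1) - 1 / real a"
      using elim by (simp add: diff_divide_distrib)
    ultimately show ?case by simp
  qed
  show "(\<lambda>a. 1 / real (k + 1) - 1 / real a) \<longlonglongrightarrow> 1 / real (k + 1)"
    using tendsto_diff[OF tendsto_const lim_1_over_n, of "1 / real (k + 1)"] by simp
qed simp

text \<open>
  This is a Riemann sum of the integral of \<open>(1 - (1 - x)^m) / x\<close> over the unit interval.
  The integrand is the sum of \<open>(1 - x)^k\<close> over \<open>k < m\<close>, which reduces the limit to
  sums of powers.
\<close>

lemma harmonic_riemann_sum:
  assumes "m \<ge> 1"
  shows "(\<lambda>a. (\<Sum>s=1..a-1. 1 / real s * (1 - (1 - real s / real a) ^ m)) + 1 / real a) \<longlonglongrightarrow> harm m"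
proof -
  let ?T = "\<lambda>a. \<Sum>k<m. (\<Sum>s<a. (real s / real a) ^ k) / real a"
  have "?T \<longlonglongrightarrow> (\<Sum>k<m. 1 / real (k + 1))"
    by (intro tendsto_sum power_sum_asymptotics)
  also have "(\<Sum>k<m. 1 / real (k + 1)) = harm m"
    unfolding harm_def
    by (rule sum.reindex_bij_witness[of _ "\<lambda>i. i - 1" Suc]) (auto simp: field_simps)
  finally have lim: "?T \<longlonglongrightarrow> harm m" .
  have "\<forall>\<^sub>F a in sequentially. ?T a =
      (\<Sum>s=1..a-1. 1 / real s * (1 - (1 - real s / real a) ^ m)) + 1 / real a"
    using eventually_gt_at_top[of 0]
  proof eventually_elim
    case (elim a)
    define g where "g s = 1 / real s * (1 - (1 - real s / real a) ^ m)" for s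
    have g: "g s = (\<Sum>k<m. (1 - real s / real a) ^ k) / real a" if "s \<ge> 1" for s
      using one_minus_times_geometric_sum[of "1 - real s / real a" m] that elim
      by (simp add: g_def field_simps)
    have "?T a = (\<Sum>s<a. (\<Sum>k<m. (real s / real a) ^ k) / real a)"
      unfolding sum_divide_distrib by (rule sum.swap)
    \<comment> \<open>Replacing \<open>s\<close> by \<open>a - s\<close> turns \<open>s / a\<close> into \<open>1 - s / a\<close>.\<close>
    also have "\<dots> = (\<Sum>s=1..a. g s)"
      by (rule sum.reindex_bij_witness[of _ "\<lambda>s. a - s" "\<lambda>s. a - s"])
         (auto simp: g of_nat_diff diff_divide_distrib)
    also have "\<dots> = (\<Sum>s=1..a-1. g s) + g a"
      using elim by (cases a) auto
    also have "g a = 1 / real a"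
      using elim assms by (simp add: g_def power_0_left)
    finally show ?case by (simp add: g_def)
  qed
  then show ?thesis using lim by (rule Lim_transform_eventually[rotated])
qed

section \<open>Expected numbers of branches\<close>

lemma sum_initial_eq:
  fixes p :: "nat \<Rightarrow> real"
  assumes "(\<Sum>s=1..a. p s) = 1" "s \<le> a"
  shows "(\<Sum>l=1..s. p l) = 1 - (\<Sum>l=s+1..a. p l)"
  using sum.ub_add_nat[of 1 s p "a - s"] assms by simp

lemma expected_branches_brt:
  assumes "prob_vector a p" "a \<ge> 1" "n \<ge> 2"
  shows "expected_branches (brt a p n) =
           (\<Sum>s=1..a-1. p s / (\<Sum>l=1..s. p l) * (1 - (\<Sum>l=s+1..a. p l) ^ (n - 1))) + p a"
proof -
  have p: "\<And>s. s \<in> {1..a} \<Longrightarrow> p s > 0" "(\<Sum>s=1..a. p s) = 1"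
    using assms by (auto simp: prob_vector_def)
  have words: "expected_branches (brt a p n) =
     (\<Sum>s=1..a. p s * (\<Sum>j<n-1. (\<Sum>l=s+1..a. p l) ^ j))"
    using expected_branches_brt_words[OF assms(1), of n] sum_words_num_lr_minima[OF p(2)] assms(3)
    by simp
  define g where "g s = p s * (\<Sum>j<n-1. (\<Sum>l=s+1..a. p l) ^ j)" for s
  have g: "g s = p s / (\<Sum>l=1..s. p l) * (1 - (\<Sum>l=s+1..a. p l) ^ (n - 1))" if "s \<in> {1..a}" for s
  proof -
    have "(\<Sum>l=1..s. p l) > 0"
      using that by (intro sum_pos p(1)) auto
    then have ne: "(\<Sum>l=1..s. p l) \<noteq> 0" by linarith
    have "(\<Sum>l=1..s. p l) * (\<Sum>j<n-1. (\<Sum>l=s+1..a. p l) ^ j) =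
        1 - (\<Sum>l=s+1..a. p l) ^ (n - 1)"
      using one_minus_times_geometric_sum[of "\<Sum>l=s+1..a. p l" "n - 1"] sum_initial_eq[OF p(2), of s] that
      by simp
    from this[symmetric] ne show ?thesis
      unfolding g_def by (simp only: times_divide_eq_left times_divide_eq_right
          mult.left_commute[of "p s"] nonzero_mult_div_cancel_left not_False_eq_True)
  qed
  \<comment> \<open>For \<open>s = a\<close> the geometric series has ratio \<open>0\<close>, and its only nonzero term is \<open>0 ^ 0 = 1\<close>.\<close>
  have ga: "g a = p a"
    using assms by (simp add: g_def power_0_left)
  have "(\<Sum>s=1..a. g s) = (\<Sum>s=1..a-1. g s) + g a"
    using assms by (cases a) auto
  also have "(\<Sum>s=1..a-1. g s) =
      (\<Sum>s=1..a-1. p s / (\<Sum>l=1..s. p l) * (1 - (\<Sum>l=s+1..a. p l) ^ (n - 1)))"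
    by (rule sum.cong[OF refl], rule g) auto
  finally show ?thesis
    unfolding words g_def[symmetric] ga .
qed

lemma expected_branches_brt_tendsto:
  assumes p: "prob_vector a p" and a: "a \<ge> 1"
  shows "(\<lambda>n. expected_branches (brt a p n)) \<longlonglongrightarrow> (\<Sum>s=1..a. p s / (\<Sum>l=1..s. p l))"
proof -
  have pos: "\<And>s. s \<in> {1..a} \<Longrightarrow> p s > 0" and one: "(\<Sum>s=1..a. p s) = 1"
    using p by (auto simp: prob_vector_def)
  have pow: "(\<lambda>n. (\<Sum>l=s+1..a. p l) ^ (n - 1)) \<longlonglongrightarrow> 0" if s: "s \<in> {1..a-1}" for s
  proof -
    have "(\<Sum>l=1..s. p l) > 0" "(\<Sum>l=s+1..a. p l) \<ge> 0"
      using s by (auto intro!: sum_pos sum_nonneg pos less_imp_le)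
    then have "(\<lambda>n. (\<Sum>l=s+1..a. p l) ^ n) \<longlonglongrightarrow> 0"
      using sum_initial_eq[OF one, of s] s by (intro LIMSEQ_realpow_zero) auto
    then show ?thesis
      by (subst filterlim_sequentially_Suc[symmetric]) simp
  qed
  have "(\<lambda>n. (\<Sum>s=1..a-1. p s / (\<Sum>l=1..s. p l) * (1 - (\<Sum>l=s+1..a. p l) ^ (n - 1))) + p a)
     \<longlonglongrightarrow> (\<Sum>s=1..a-1. p s / (\<Sum>l=1..s. p l) * (1 - 0)) + p a"
    by (intro tendsto_intros pow)
  also have "(\<Sum>s=1..a-1. p s / (\<Sum>l=1..s. p l) * (1 - 0)) + p a = (\<Sum>s=1..a. p s / (\<Sum>l=1..s. p l))"
    using a one by (cases a) auto
  finally show ?thesis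
  proof (rule Lim_transform_eventually)
    show "\<forall>\<^sub>F n in sequentially.
        (\<Sum>s=1..a-1. p s / (\<Sum>l=1..s. p l) * (1 - (\<Sum>l=s+1..a. p l) ^ (n - 1))) + p a =
        expected_branches (brt a p n)"
      using eventually_ge_at_top[of 2]
      by (rule eventually_mono) (rule expected_branches_brt[OF p a, symmetric])
  qed
qed

lemma prob_vector_uniform: "a \<ge> 1 \<Longrightarrow> prob_vector a (\<lambda>s. 1 / real a)"
  by (simp add: prob_vector_def)

lemma expected_branches_rt:
  assumes a: "a \<ge> 1" and n: "n \<ge> 2"
  shows "expected_branches (rt a n) =
     (\<Sum>s=1..a-1. 1 / real s * (1 - (1 - real s / real a) ^ (n - 1))) + 1 / real a"
  unfolding rt_def expected_branches_brt[OF prob_vector_uniform[OF a] a n] using a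
  by (intro arg_cong2[where f = "(+)"] sum.cong refl) (auto simp: of_nat_diff diff_divide_distrib)

lemma expected_branches_rt_tendsto:
  assumes a: "a \<ge> 1"
  shows "(\<lambda>n. expected_branches (rt a n)) \<longlonglongrightarrow> harm a"
proof -
  have "(\<Sum>s=1..a. 1 / real a / (\<Sum>l=1..s. 1 / real a)) = harm a"
    unfolding harm_def using a by (intro sum.cong) (auto simp: field_simps)
  then show ?thesis
    using expected_branches_brt_tendsto[OF prob_vector_uniform[OF a] a]
    unfolding rt_def by (simp only:)
qed

lemma expected_branches_rt_tendsto_urt:
  assumes n: "n \<ge> 2"
  shows "(\<lambda>a. expected_branches (rt a n)) \<longlonglongrightarrow> harm (n - 1)"
proof (rule Lim_transform_eventually)
  show "(\<lambda>a. (\<Sum>s=1..a-1. 1 / real s * (1 - (1 - real s / real a) ^ (n - 1))) + 1 / real a)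
      \<longlonglongrightarrow> harm (n - 1)"
    using n by (intro harmonic_riemann_sum) simp
  show "\<forall>\<^sub>F a in sequentially.
      (\<Sum>s=1..a-1. 1 / real s * (1 - (1 - real s / real a) ^ (n - 1))) + 1 / real a =
      expected_branches (rt a n)"
    using eventually_ge_at_top[of 1]
    by (rule eventually_mono) (rule expected_branches_rt[OF _ n, symmetric])
qed

theorem theorem3p1:
  "(\<forall>(a::nat) (p::nat \<Rightarrow> real). a \<ge> 1 \<longrightarrow> prob_vector a p \<longrightarrow>
      (\<forall>n::nat. n \<ge> 2 \<longrightarrow>
         expected_branches (brt a p n) =
           (\<Sum>s=1..a-1. p s / (\<Sum>l=1..s. p l) * (1 - (\<Sum>l=s+1..a. p l) ^ (n - 1))) + p a) \<and>
      (\<lambda>n. expected_branches (brt a p n)) \<longlonglongrightarrow> (\<Sum>s=1..a. p s / (\<Sum>l=1..s. p l))) \<and>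
   (\<forall>a::nat. a \<ge> 2 \<longrightarrow>
      (\<forall>n::nat. n \<ge> 2 \<longrightarrow>
         expected_branches (rt a n) =
           (\<Sum>s=1..a-1. 1 / real s * (1 - (1 - real s / real a) ^ (n - 1))) + 1 / real a) \<and>
      (\<lambda>n. expected_branches (rt a n)) \<longlonglongrightarrow> (harm a :: real)) \<and>
   (\<forall>n::nat. n \<ge> 2 \<longrightarrow>
      (\<lambda>a. expected_branches (rt a n)) \<longlonglongrightarrow> (harm (n - 1) :: real) \<and>
      expected_branches (urt n) = (harm (n - 1) :: real))"
proof (intro conjI allI impI)
  fix a n :: nat and p :: "nat \<Rightarrow> real"
  assume "a \<ge> 1" "prob_vector a p" "n \<ge> 2"
  then show "expected_branches (brt a p n) =
      (\<Sum>s=1..a-1. p s / (\<Sum>l=1..s. p l) * (1 - (\<Sum>l=s+1..a. p l) ^ (n - 1))) + p a"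
    by (intro expected_branches_brt)
next
  fix a :: nat and p :: "nat \<Rightarrow> real"
  assume "a \<ge> 1" "prob_vector a p"
  then show "(\<lambda>n. expected_branches (brt a p n)) \<longlonglongrightarrow> (\<Sum>s=1..a. p s / (\<Sum>l=1..s. p l))"
    by (intro expected_branches_brt_tendsto)
next
  fix a n :: nat
  assume "a \<ge> 2" "n \<ge> 2"
  then show "expected_branches (rt a n) =
      (\<Sum>s=1..a-1. 1 / real s * (1 - (1 - real s / real a) ^ (n - 1))) + 1 / real a"
    by (intro expected_branches_rt) simp_all
next
  fix a :: nat
  assume "a \<ge> 2"
  then show "(\<lambda>n. expected_branches (rt a n)) \<longlonglongrightarrow> harm a"
    by (intro expected_branches_rt_tendsto) simp
next
  fix n :: nat
  assume "n \<ge> 2"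
  then show "(\<lambda>a. expected_branches (rt a n)) \<longlonglongrightarrow> harm (n - 1)"
    by (rule expected_branches_rt_tendsto_urt)
next
  fix n :: nat
  assume "n \<ge> 2"
  then show "expected_branches (urt n) = harm (n - 1)"
    by (intro expected_branches_urt) simp
qed

end
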